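(* Let $p\ge 2$ and let $1\le n_1\le\cdots\le n_p$ be integers. Then $$\psi_{sq}(K_{n_1,\ldots,n_p})=\max\{2,n_p\}.$$ In particular, the value is $n_p$ whenever $n_p\ge 2$.
   Context: All graphs are finite, simple and undirected. $K_{n_1,\ldots,n_p}$ is the complete multipartite graph with parts of sizes $n_1,\ldots,n_p$. $N_G[v]$ denotes the closed neighborhood of $v$ in $G$. A sub-quorum coloring of $G$ with $k$ colors is an onto partial map $f:V(G)\dashrightarrow\{1,\ldots,k\}$ such that, with $S=\operatorname{dom}(f)$, every $v\in S$ satisfies $|\{u\in N_G[v]\cap S: f(u)=f(v)\}|\ge\frac12|N_G[v]\cap S|$; $\psi_{sq}(G)$ is the maximum such $k$. *)

theory Defs
  imports Complex_Main "HOL-Library.Disjoint_Sets" "Graph_Theory.Digraph"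
begin

text \<open>
  Finite simple undirected graphs are the locale \<^locale>\<open>graph\<close> of the library: finite, loop-free,
  symmetric digraphs without parallel arcs.  The undirected edge between u and v is the pair of arcs
  from u to v and from v to u, so u and v are adjacent iff u dominates v.
\<close>

definition closed_neighborhood :: "('a, 'b) pre_digraph \<Rightarrow> 'a \<Rightarrow> 'a set" where
  "closed_neighborhood G v = insert v {u \<in> verts G. v \<rightarrow>\<^bsub>G\<^esub> u}"

text \<open>
  The parts are V 1, ..., V p and have sizes n 1, ..., n p.  This is a predicate on graphs with
  arbitrary vertex and arc types, holding for all graphs isomorphic to the complete multipartite
  graph with the given part sizes.
\<close>

definition complete_multipartite :: "nat \<Rightarrow> (nat \<Rightarrow> nat) \<Rightarrow> ('a, 'b) pre_digraph \<Rightarrow> bool" where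
  "complete_multipartite p n G \<longleftrightarrow> graph G \<and>
     (\<exists>V. disjoint_family_on V {1..p} \<and> verts G = (\<Union>i\<in>{1..p}. V i) \<and>
          (\<forall>i\<in>{1..p}. card (V i) = n i) \<and>
          arcs_ends G = (\<Union>i\<in>{1..p}. \<Union>j\<in>{1..p} - {i}. V i \<times> V j))"

text \<open>
  A partial map f with domain S; the condition on the range says that it is onto the k colors.
\<close>

definition sub_quorum_coloring :: "('a, 'b) pre_digraph \<Rightarrow> nat \<Rightarrow> ('a \<rightharpoonup> nat) \<Rightarrow> bool" where
  "sub_quorum_coloring G k f \<longleftrightarrow> dom f \<subseteq> verts G \<and> ran f = {1..k} \<and>
     (\<forall>v\<in>dom f. real (card {u \<in> closed_neighborhood G v \<inter> dom f. f u = f v})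
        \<ge> 1/2 * real (card (closed_neighborhood G v \<inter> dom f)))"

definition sub_quorum_number :: "('a, 'b) pre_digraph \<Rightarrow> nat" (\<open>\<psi>\<^sub>s\<^sub>q\<close>) where
  "\<psi>\<^sub>s\<^sub>q G = Max {k. \<exists>f. sub_quorum_coloring G k f}"

text \<open>
  The maximum is taken over a finite nonempty set (the empty map uses 0 colors), hence it is attained.
\<close>

lemma sub_quorum_coloring_le_card:
  assumes "graph G" "sub_quorum_coloring G k f"
  shows "k \<le> card (verts G)"
proof -
  interpret graph G by fact
  have sub: "dom f \<subseteq> verts G" and ran: "ran f = {1..k}"
    using assms(2) by (auto simp: sub_quorum_coloring_def)
  have fin: "finite (dom f)" using sub finite_verts finite_subset by blast
  have "ran f = (\<lambda>x. the (f x)) ` dom f" by (force simp: ran_def dom_def image_iff)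
  then have "card (ran f) \<le> card (dom f)" using fin card_image_le by metis
  also have "\<dots> \<le> card (verts G)" using sub finite_verts by (intro card_mono) auto
  finally show ?thesis using ran by simp
qed

lemma sub_quorum_number_attained:
  assumes "graph G"
  shows "\<exists>f. sub_quorum_coloring G (\<psi>\<^sub>s\<^sub>q G) f"
    and "sub_quorum_coloring G k f \<Longrightarrow> k \<le> \<psi>\<^sub>s\<^sub>q G"
proof -
  let ?K = "{k. \<exists>f. sub_quorum_coloring G k f}"
  have "?K \<subseteq> {..card (verts G)}" using sub_quorum_coloring_le_card[OF assms] by auto
  then have fin: "finite ?K" using finite_subset by blast
  have "sub_quorum_coloring G 0 Map.empty" by (simp add: sub_quorum_coloring_def)
  then have ne: "?K \<noteq> {}" by blast
  show "\<exists>f. sub_quorum_coloring G (\<psi>\<^sub>s\<^sub>q G) f"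
    using Max_in[OF fin ne] by (simp add: sub_quorum_number_def)
  show "sub_quorum_coloring G k f \<Longrightarrow> k \<le> \<psi>\<^sub>s\<^sub>q G"
    unfolding sub_quorum_number_def using fin by (intro Max_ge) auto
qed

lemma complete_multipartite_exists:
  "\<exists>G :: (nat \<times> nat, (nat \<times> nat) \<times> (nat \<times> nat)) pre_digraph. complete_multipartite p n G"
proof -
  define V where "V i = {i} \<times> {..<n i}" for i
  define W where "W = (\<Union>i\<in>{1..p}. V i)"
  define E where "E = (\<Union>i\<in>{1..p}. \<Union>j\<in>{1..p} - {i}. V i \<times> V j)"
  define G where "G = \<lparr>verts = W, arcs = E, tail = fst, head = snd\<rparr>"
  have ends: "arcs_ends G = E" by (auto simp: G_def arcs_ends_def arc_to_ends_def)
  have fin: "finite W" by (auto simp: W_def V_def)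
  have sub: "E \<subseteq> W \<times> W" by (auto simp: W_def E_def)
  then have finE: "finite E" using fin finite_subset by blast
  have irr: "\<And>e. e \<in> E \<Longrightarrow> fst e \<noteq> snd e" by (auto simp: E_def V_def)
  have sym: "symmetric G" unfolding symmetric_def ends by (auto simp: E_def sym_def)
  have "graph G"
    by unfold_locales
      (use fin finE sub irr sym in \<open>auto simp: G_def arc_to_ends_def\<close>)
  moreover have "disjoint_family_on V {1..p}" by (auto simp: disjoint_family_on_def V_def)
  moreover have "verts G = (\<Union>i\<in>{1..p}. V i)" by (simp add: G_def W_def)
  moreover have "\<forall>i\<in>{1..p}. card (V i) = n i" by (simp add: V_def)
  ultimately have "complete_multipartite p n G"
    unfolding complete_multipartite_def using ends E_def by blast
  then show ?thesis by blast
qed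

end

theory Submission
  imports Defs
begin

text \<open>
  Write S for the domain of a coloring, N for its size and \<open>s\<^sub>i\<close> for the number of its vertices in
  the part \<open>V i\<close>.  A vertex of S in \<open>V i\<close> has \<open>N - s\<^sub>i + 1\<close> vertices of S in its closed
  neighborhood, itself included, so the quorum condition forces its color class to have at least half
  that size.

  For the lower bound, coloring only the vertices of the largest part, all differently, works because
  a part is independent; and two differently colored vertices always work, since each of them makes
  up at least half of what it sees.

  For the upper bound, suppose that \<open>k \<ge> 3\<close> colors are used although every part has fewer
  than k vertices.  Then the closed neighborhoods, and hence the color classes, are large: each class
  has at least \<open>(N - k + 2)/2\<close> vertices.  The smallest class has \<open>m \<le> N/k\<close> vertices, so
  \<open>k m \<le> N \<le> 2 m + k - 2\<close>, that is, \<open>(k - 2)(m - 1) \<le> 0\<close>.  Hence \<open>m = 1\<close> and \<open>N = k\<close>: all colors are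
  different, so every vertex of S has at most one neighbor in S.  Then every part that meets S
  misses at most one vertex of S.  Since no part contains S, two parts meet S, and being disjoint
  they give \<open>2 (k - 1) \<le> k\<close>, which contradicts \<open>k \<ge> 3\<close>.
\<close>

section \<open>Color classes of a sub-quorum coloring\<close>

context
  fixes G :: "('a, 'b) pre_digraph" and k :: nat and f :: "'a \<rightharpoonup> nat"
  assumes graph: "graph G" and coloring: "sub_quorum_coloring G k f"
begin

lemma finite_dom_coloring: "finite (dom f)"
proof -
  interpret graph G by (fact graph)
  show ?thesis
    using coloring finite_verts finite_subset unfolding sub_quorum_coloring_def by blast
qed

lemma image_dom_coloring: "f ` dom f = Some ` {1..k}"
proof -
  have "Some ` ran f = f ` dom f" by (force simp: ran_def dom_def image_iff)
  then show ?thesis using coloring by (simp add: sub_quorum_coloring_def)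
qed

lemma closed_neighborhood_le_twice_color_class:
  assumes "v \<in> dom f"
  shows "card (closed_neighborhood G v \<inter> dom f) \<le> 2 * card {u \<in> dom f. f u = f v}"
proof -
  have "card {u \<in> closed_neighborhood G v \<inter> dom f. f u = f v} \<le> card {u \<in> dom f. f u = f v}"
    using finite_dom_coloring by (intro card_mono) auto
  moreover have "real (card {u \<in> closed_neighborhood G v \<inter> dom f. f u = f v})
      \<ge> 1/2 * real (card (closed_neighborhood G v \<inter> dom f))"
    using coloring assms unfolding sub_quorum_coloring_def by blast
  ultimately show ?thesis by linarith
qed

lemma exists_color_class_at_most_average:
  assumes "k \<ge> 1"
  obtains v where "v \<in> dom f" "k * card {u \<in> dom f. f u = f v} \<le> card (dom f)"
proof -
  have "\<exists>c\<in>{1..k}. k * card {u \<in> dom f. f u = Some c} \<le> card (dom f)"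
  proof (rule ccontr)
    assume "\<not> ?thesis"
    then have "\<And>c. c \<in> {1..k} \<Longrightarrow> card (dom f) < k * card {u \<in> dom f. f u = Some c}"
      by (auto simp: not_le)
    then have "(\<Sum>c\<in>{1..k}. card (dom f)) < (\<Sum>c\<in>{1..k}. k * card {u \<in> dom f. f u = Some c})"
      using assms by (intro sum_strict_mono) auto
    also have "\<dots> = k * (\<Sum>c\<in>{1..k}. card {u \<in> dom f. f u = Some c})"
      by (simp add: sum_distrib_left)
    also have "(\<Sum>c\<in>{1..k}. card {u \<in> dom f. f u = Some c})
        = card (\<Union>c\<in>{1..k}. {u \<in> dom f. f u = Some c})"
      using finite_dom_coloring by (intro card_UN_disjoint[symmetric]) auto
    also have "(\<Union>c\<in>{1..k}. {u \<in> dom f. f u = Some c}) = dom f"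
      using image_dom_coloring by blast
    finally show False by simp
  qed
  then obtain c where c: "c \<in> {1..k}" "k * card {u \<in> dom f. f u = Some c} \<le> card (dom f)"
    by blast
  obtain v where "v \<in> dom f" "f v = Some c"
    using c(1) image_dom_coloring by (metis imageE imageI)
  then show thesis using c(2) that by metis
qed

end

section \<open>Closed neighborhoods in complete multipartite graphs\<close>

lemma closed_neighborhood_complete_multipartite:
  assumes "disjoint_family_on V I" "verts G = (\<Union>i\<in>I. V i)"
    and "arcs_ends G = (\<Union>i\<in>I. \<Union>j\<in>I - {i}. V i \<times> V j)"
    and "i \<in> I" "v \<in> V i"
  shows "closed_neighborhood G v = insert v (verts G - V i)"
proof -
  have same: "j = i" if "j \<in> I" "u \<in> V i" "u \<in> V j" for j u
    using that assms(1,4) unfolding disjoint_family_on_def by blast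
  have "v \<rightarrow>\<^bsub>G\<^esub> u \<longleftrightarrow> (\<exists>j\<in>I - {i}. u \<in> V j)" for u
    unfolding assms(3) using assms(4,5) same by blast
  then show ?thesis
    unfolding closed_neighborhood_def assms(2) using same by blast
qed

locale complete_multipartite_graph =
  fixes G :: "('a, 'b) pre_digraph" and I :: "'i set" and V :: "'i \<Rightarrow> 'a set"
  assumes graph: "graph G"
    and disjoint: "disjoint_family_on V I"
    and verts_eq: "verts G = (\<Union>i\<in>I. V i)"
    and closed_neighborhood_eq:
      "i \<in> I \<Longrightarrow> v \<in> V i \<Longrightarrow> closed_neighborhood G v = insert v (verts G - V i)"
begin

text \<open>
  A set of vertices splits into its vertices in the part of v and those in the neighborhood
  of v; only v itself is counted twice.
\<close>

lemma card_closed_neighborhood_add_part: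
  assumes "S \<subseteq> verts G" "i \<in> I" "v \<in> S \<inter> V i"
  shows "card (closed_neighborhood G v \<inter> S) + card (S \<inter> V i) = card S + 1"
proof -
  interpret graph G by (fact graph)
  have fin: "finite S" using assms(1) finite_verts finite_subset by blast
  have "closed_neighborhood G v \<inter> S = insert v (S - V i)"
    using closed_neighborhood_eq[OF assms(2)] assms by blast
  moreover have "card (insert v (S - V i)) = Suc (card (S - V i))"
    using fin assms(3) by (intro card_insert_disjoint) auto
  moreover have "card S = card (S \<inter> V i) + card (S - V i)"
    using fin by (metis Int_lower1 Diff_Int_distrib2 card_Int_Diff)
  ultimately show ?thesis by simp
qed

section \<open>The upper bound\<close>

text \<open>
  Small parts make every color class large, so a class of at most average size is a singleton, and
  there are just k colored vertices.  With three or more of them, two parts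
  cannot both contain all colored vertices but one.  The bound needs three colors: one
  vertex in each of two parts gives two colors even if all parts are singletons.
\<close>

lemma colors_le_card_part:
  assumes coloring: "sub_quorum_coloring G k f" and "k \<ge> 3"
  shows "\<exists>i\<in>I. k \<le> card (V i)"
proof (rule ccontr)
  assume "\<not> ?thesis"
  then have small: "card (V i) < k" if "i \<in> I" for i using that by force
  interpret graph G by (fact graph)
  define S where "S = dom f"
  have S_verts: "S \<subseteq> verts G" using coloring by (simp add: sub_quorum_coloring_def S_def)
  have fin: "finite S" using finite_dom_coloring[OF graph coloring] by (simp add: S_def)
  have part_of: "\<exists>i\<in>I. v \<in> S \<inter> V i" if "v \<in> S" for v
    using that S_verts verts_eq by blast
  have S_part: "card (S \<inter> V i) < k" if "i \<in> I" for i
  proof -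
    have "finite (V i)" using that verts_eq finite_verts by (metis UN_upper finite_subset)
    then have "card (S \<inter> V i) \<le> card (V i)" by (intro card_mono) auto
    then show ?thesis using small[OF that] by simp
  qed
  have quorum: "card S + 1 \<le> 2 * card {u \<in> S. f u = f v} + card (S \<inter> V i)"
    if "i \<in> I" "v \<in> S \<inter> V i" for v i
    using closed_neighborhood_le_twice_color_class[OF graph coloring, of v]
      card_closed_neighborhood_add_part[OF S_verts that] that by (simp add: S_def)

  obtain v where v: "v \<in> S" "k * card {u \<in> S. f u = f v} \<le> card S"
    using exists_color_class_at_most_average[OF graph coloring] \<open>k \<ge> 3\<close> by (auto simp: S_def)
  define m where "m = card {u \<in> S. f u = f v}"
  obtain i where i: "i \<in> I" "v \<in> S \<inter> V i" using part_of v(1) by blast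
  have "v \<in> {u \<in> S. f u = f v}" using v(1) by simp
  then have "m \<noteq> 0" using fin by (auto simp: m_def)
  have upper: "card S + 2 \<le> 2 * m + k"
    using quorum[OF i] S_part[OF i(1)] by (simp add: m_def)
  have "m = 1"
  proof (rule ccontr)
    assume "m \<noteq> 1"
    \<comment> \<open>The two bounds on \<open>card S\<close> give \<open>(k - 2) (m - 1) \<le> 0\<close>; here \<open>k - 2 = b + 1\<close> and \<open>m - 1 = a + 1\<close>.\<close>
    then have "2 \<le> m" using \<open>m \<noteq> 0\<close> by simp
    then obtain a where "m = 2 + a" by (rule le_Suc_ex[THEN exE])
    moreover obtain b where "k = 3 + b" using \<open>k \<ge> 3\<close> by (rule le_Suc_ex[THEN exE])
    ultimately show False using upper v(2) by (simp add: m_def[symmetric] algebra_simps)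
  qed
  then have card_S: "card S = k" using upper v(2) by (simp add: m_def)

  have "inj_on f S"
    using image_dom_coloring[OF graph coloring] card_S fin
    by (intro eq_card_imp_inj_on) (auto simp: S_def card_image)
  then have class_singleton: "{u \<in> S. f u = f w} = {w}" if "w \<in> S" for w
    using that by (auto dest: inj_onD)
  have almost_all: "k \<le> card (S \<inter> V j) + 1" if "j \<in> I" "w \<in> S \<inter> V j" for w j
    using quorum[OF that] class_singleton[of w] that card_S by simp

  have "\<not> S \<subseteq> V i" using S_part[OF i(1)] card_S by (metis inf.orderE less_irrefl)
  then obtain w where w: "w \<in> S" "w \<notin> V i" by blast
  obtain j where j: "j \<in> I" "w \<in> S \<inter> V j" using part_of w(1) by blast
  have "V i \<inter> V j = {}"
    using disjoint_family_onD[OF disjoint i(1) j(1)] j(2) w(2) by blast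
  then have "card (S \<inter> V i) + card (S \<inter> V j) = card ((S \<inter> V i) \<union> (S \<inter> V j))"
    using fin by (intro card_Un_disjoint[symmetric]) auto
  also have "\<dots> \<le> k" using fin card_S by (metis Int_Un_distrib Int_lower1 card_mono)
  finally show False using almost_all[OF i] almost_all[OF j] \<open>k \<ge> 3\<close> by simp
qed

end

section \<open>The lower bounds\<close>

text \<open>
  With all colors different, the quorum condition says precisely that every vertex of S has at
  most one neighbor in S; both colorings that attain the maximum are of this kind.
\<close>

lemma coloring_with_distinct_colors:
  assumes "finite S" "S \<subseteq> verts G"
    and matching: "\<And>v. v \<in> S \<Longrightarrow> card (closed_neighborhood G v \<inter> S) \<le> 2"
  shows "\<exists>f. sub_quorum_coloring G (card S) f"
proof -
  obtain h where h: "bij_betw h S {1..card S}"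
    using finite_same_card_bij[of S "{1..card S}"] assms(1) by auto
  define f where "f = (\<lambda>v. if v \<in> S then Some (h v) else None)"
  have dom: "dom f = S" by (auto simp: f_def split: if_splits)
  have "ran f = h ` S" by (auto simp: f_def ran_def)
  then have ran: "ran f = {1..card S}" using h by (simp add: bij_betw_def)
  have "real (card {u \<in> closed_neighborhood G v \<inter> S. f u = f v})
      \<ge> 1/2 * real (card (closed_neighborhood G v \<inter> S))" if "v \<in> S" for v
  proof -
    have "{u \<in> closed_neighborhood G v \<inter> S. f u = f v} = {v}"
      using that h by (auto simp: f_def closed_neighborhood_def bij_betw_def dest: inj_onD)
    then show ?thesis using matching[OF that] by simp
  qed
  then show ?thesis
    using dom ran assms(2) unfolding sub_quorum_coloring_def by auto
qed

lemma two_colors: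
  assumes "u \<in> verts G" "v \<in> verts G" "u \<noteq> v"
  shows "\<exists>f. sub_quorum_coloring G 2 f"
proof -
  have "card (A \<inter> {u, v}) \<le> 2" for A
    using card_mono[of "{u, v}" "A \<inter> {u, v}"] assms(3) by simp
  then have "\<exists>f. sub_quorum_coloring G (card {u, v}) f"
    using assms by (intro coloring_with_distinct_colors) auto
  moreover have "card {u, v} = 2" using assms(3) by simp
  ultimately show ?thesis by metis
qed

lemma (in complete_multipartite_graph) rainbow_part:
  assumes "i \<in> I"
  shows "\<exists>f. sub_quorum_coloring G (card (V i)) f"
proof (rule coloring_with_distinct_colors)
  interpret graph G by (fact graph)
  show sub: "V i \<subseteq> verts G" using assms verts_eq by blast
  then show "finite (V i)" using finite_verts finite_subset by blast
  fix v assume "v \<in> V i"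
  then have "closed_neighborhood G v \<inter> V i = {v}"
    using closed_neighborhood_eq[OF assms] by blast
  then show "card (closed_neighborhood G v \<inter> V i) \<le> 2" by simp
qed

section \<open>The sub-quorum number of complete multipartite graphs\<close>

theorem theorem5p11:
  fixes p :: nat and n :: "nat \<Rightarrow> nat" and G :: "('a, 'b) pre_digraph"
  assumes "p \<ge> 2"
    and "1 \<le> n 1"
    and "mono_on {1..p} n"
    and "complete_multipartite p n G"
  shows "\<psi>\<^sub>s\<^sub>q G = max 2 (n p) \<and> (n p \<ge> 2 \<longrightarrow> \<psi>\<^sub>s\<^sub>q G = n p)"
proof -
  obtain V where graph: "graph G" and disjoint: "disjoint_family_on V {1..p}"
    and verts: "verts G = (\<Union>i\<in>{1..p}. V i)"
    and card_V: "\<And>i. i \<in> {1..p} \<Longrightarrow> card (V i) = n i"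
    and ends: "arcs_ends G = (\<Union>i\<in>{1..p}. \<Union>j\<in>{1..p} - {i}. V i \<times> V j)"
    using assms(4) unfolding complete_multipartite_def by blast
  interpret complete_multipartite_graph G "{1..p}" V
    by (rule complete_multipartite_graph.intro[OF graph disjoint verts
          closed_neighborhood_complete_multipartite[OF disjoint verts ends]])
  have n_bounds: "1 \<le> n i" "n i \<le> n p" if "i \<in> {1..p}" for i
    using that assms(1,2) monotone_onD[OF assms(3), of 1 i] monotone_onD[OF assms(3), of i p]
    by auto

  have "n p \<le> \<psi>\<^sub>s\<^sub>q G"
    using rainbow_part[of p] card_V[of p] sub_quorum_number_attained(2)[OF graph] assms(1) by auto
  moreover have "2 \<le> \<psi>\<^sub>s\<^sub>q G"
  proof -
    have "V 1 \<noteq> {}" "V 2 \<noteq> {}"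
      using n_bounds(1)[of 1] n_bounds(1)[of 2] card_V[of 1] card_V[of 2] assms(1) by auto
    then obtain u v where uv: "u \<in> V 1" "v \<in> V 2" by blast
    have "V 1 \<inter> V 2 = {}"
      using disjoint assms(1) by (simp add: disjoint_family_on_def)
    then have "u \<noteq> v" using uv by blast
    moreover have "u \<in> verts G" "v \<in> verts G"
      using uv assms(1) unfolding verts by (auto intro: bexI[of _ 1] bexI[of _ 2])
    ultimately obtain f where "sub_quorum_coloring G 2 f"
      using two_colors by metis
    then show ?thesis by (rule sub_quorum_number_attained(2)[OF graph])
  qed
  moreover have "\<psi>\<^sub>s\<^sub>q G \<le> max 2 (n p)"
  proof (cases "\<psi>\<^sub>s\<^sub>q G \<ge> 3")
    case True
    obtain f where "sub_quorum_coloring G (\<psi>\<^sub>s\<^sub>q G) f"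
      using sub_quorum_number_attained(1)[OF graph] by blast
    from colors_le_card_part[OF this True]
    obtain i where "i \<in> {1..p}" "\<psi>\<^sub>s\<^sub>q G \<le> card (V i)" by blast
    then have "\<psi>\<^sub>s\<^sub>q G \<le> n p" using card_V n_bounds(2) le_trans by metis
    then show ?thesis by simp
  qed simp
  ultimately show ?thesis by (auto simp: max_def split: if_splits)
qed

end
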